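(* For every integer $n\geq 2$ and every $i\in\{1,\ldots,n-1\}$, there exists a $3i$-eigenfunction $f$ of the Hamming graph $H(n,3)$ such that $\mathrm{SND}(f)=2$.
   Context: The Hamming graph $H(n,q)$ has vertex set $\mathbb{Z}_q^n$, two vertices being adjacent iff they differ in exactly one coordinate. For a graph $G$ with vertex set $V$ and a real number $\lambda$, a $\lambda$-eigenfunction of $G$ is a function $f:V\to\mathbb{R}$ with $f\not\equiv 0$ such that $\lambda f(x)=\sum_{y\in N(x)}(f(x)-f(y))$ for every $x\in V$, where $N(x)$ is the set of neighbours of $x$. A positive (negative) strong nodal domain of $f$ is a maximal connected induced subgraph of $G$ on vertices $x$ with $f(x)>0$ ($f(x)<0$); $\mathrm{SND}(f)$ denotes the total number of strong nodal domains of $f$. *)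

theory Defs
  imports Complex_Main "HOL-Library.FuncSet" "Graph_Theory.Digraph_Component"
begin

text \<open>
  Undirected simple graphs are symmetric loop-free digraphs without parallel arcs
  (\<^locale>\<open>pair_graph\<close>): an edge is represented by the two arcs between its end points.
  Vertices of the Hamming graph are extensional functions from the coordinates \<open>{..<n}\<close>
  to \<open>{..<q}\<close>; the additive structure of the residues modulo \<open>q\<close> plays no role.
\<close>

definition hamming_graph :: "nat \<Rightarrow> nat \<Rightarrow> (nat \<Rightarrow> nat) pair_pre_digraph" where
  "hamming_graph n q =
    \<lparr> pverts = {..<n} \<rightarrow>\<^sub>E {..<q},
      parcs = {(x, y). x \<in> {..<n} \<rightarrow>\<^sub>E {..<q} \<and> y \<in> {..<n} \<rightarrow>\<^sub>E {..<q} \<and>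
                       card {k \<in> {..<n}. x k \<noteq> y k} = 1} \<rparr>"

lemma pair_graph_hamming_graph: "pair_graph (hamming_graph n q)"
proof -
  let ?V = "{..<n} \<rightarrow>\<^sub>E {..<q}" and ?G = "hamming_graph n q"
  have fin: "finite ?V"
    by (intro finite_PiE) auto
  have sub: "parcs ?G \<subseteq> ?V \<times> ?V"
    by (auto simp: hamming_graph_def)
  have "finite (parcs ?G)"
    using finite_subset[OF sub] fin by simp
  moreover have "finite (pverts ?G)"
    using fin by (simp add: hamming_graph_def)
  moreover have "symmetric (with_proj ?G)"
  proof -
    have "(y, x) \<in> parcs ?G" if "(x, y) \<in> parcs ?G" for x y
    proof -
      have "{k \<in> {..<n}. y k \<noteq> x k} = {k \<in> {..<n}. x k \<noteq> y k}"
        by (rule Collect_cong) metis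
      then have "card {k \<in> {..<n}. y k \<noteq> x k} = card {k \<in> {..<n}. x k \<noteq> y k}"
        by (rule arg_cong)
      with that show ?thesis
        by (simp add: hamming_graph_def)
    qed
    then show ?thesis
      unfolding symmetric_def sym_def with_proj_simps by blast
  qed
  moreover have "fst e \<in> pverts ?G" "snd e \<in> pverts ?G" "fst e \<noteq> snd e" if "e \<in> parcs ?G" for e
    using that by (cases e; force simp: hamming_graph_def)+
  ultimately show ?thesis
    by unfold_locales
qed

definition neighbours :: "'a pair_pre_digraph \<Rightarrow> 'a \<Rightarrow> 'a set" where
  "neighbours G x = {y. (x, y) \<in> parcs G}"

text \<open>Only the values of \<open>f\<close> on the vertices matter, in particular in \<open>f \<noteq> 0\<close>.\<close>

definition eigenfunction :: "'a pair_pre_digraph \<Rightarrow> real \<Rightarrow> ('a \<Rightarrow> real) \<Rightarrow> bool" where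
  "eigenfunction G lam f \<longleftrightarrow>
    (\<exists>x\<in>pverts G. f x \<noteq> 0) \<and>
    (\<forall>x\<in>pverts G. lam * f x = (\<Sum>y\<in>neighbours G x. f x - f y))"

text \<open>
  The predicate \<^const>\<open>Digraph_Component.connected\<close> includes nonemptiness. An induced subgraph
  is determined by its vertex set, so maximality is expressed by inclusion of vertex sets.
\<close>

definition max_connected_induced_on ::
    "'a pair_pre_digraph \<Rightarrow> 'a set \<Rightarrow> ('a, 'a \<times> 'a) pre_digraph set" where
  "max_connected_induced_on G S =
    {H. induced_subgraph H (with_proj G) \<and> Digraph_Component.connected H \<and> verts H \<subseteq> S \<and>
        \<not> (\<exists>H'. induced_subgraph H' (with_proj G) \<and> Digraph_Component.connected H' \<and>
                verts H' \<subseteq> S \<and> verts H \<subset> verts H')}"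

definition pos_strong_nodal_domains ::
    "'a pair_pre_digraph \<Rightarrow> ('a \<Rightarrow> real) \<Rightarrow> ('a, 'a \<times> 'a) pre_digraph set" where
  "pos_strong_nodal_domains G f = max_connected_induced_on G {x \<in> pverts G. f x > 0}"

definition neg_strong_nodal_domains ::
    "'a pair_pre_digraph \<Rightarrow> ('a \<Rightarrow> real) \<Rightarrow> ('a, 'a \<times> 'a) pre_digraph set" where
  "neg_strong_nodal_domains G f = max_connected_induced_on G {x \<in> pverts G. f x < 0}"

definition SND :: "'a pair_pre_digraph \<Rightarrow> ('a \<Rightarrow> real) \<Rightarrow> nat" where
  "SND G f = card (pos_strong_nodal_domains G f \<union> neg_strong_nodal_domains G f)"

end

theory Submission
  imports Defs
begin

text \<open>
  Write \<open>F i\<close> for \<open>eigenfun i\<close>: \<open>F 0 = 1\<close> and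
  \<open>F (i + 1) = (2 ^ (i + 1) + 1) * F i * b (x (i + 1)) + (\<Prod>k\<le>i. a (x k))\<close>
  with the zero-sum weights \<open>a = (1, 1, -2)\<close> and \<open>b = (1, -1, 0)\<close>. Both summands of
  \<open>F (i + 1)\<close> are sums of characters of weight \<open>i + 1\<close>, so \<open>F i\<close> is an eigenfunction for \<open>3i\<close>.
  Since \<open>\<bar>F i\<bar> \<ge> 1\<close> and the product is at most \<open>2 ^ (i + 1)\<close> in absolute value, the sign of
  \<open>F (i + 1)\<close> on the layers \<open>x (i + 1) = 0, 1, 2\<close> is that of \<open>F i\<close>, of \<open>- F i\<close> and of the product.
  Inductively a sign class of \<open>F (i + 1)\<close> is connected within each of the first two layers,
  and every point of layer 2 is adjacent to one of these two pieces. The two pieces are joined by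
  an edge of layer 2 in direction \<open>i\<close> along which \<open>F i\<close> changes sign while the product does not.
\<close>

section \<open>Connected vertex sets and nodal domains\<close>

text \<open>Holds for the empty set, unlike \<open>Digraph_Component.connected\<close>; so an empty
  sign class needs no special treatment in the induction.\<close>

definition linked :: "'a rel \<Rightarrow> 'a set \<Rightarrow> bool" where
  "linked E S \<longleftrightarrow> (\<forall>u\<in>S. \<forall>v\<in>S. (u, v) \<in> rtrancl_on S E)"

lemma rtrancl_on_edge:
  "(x, y) \<in> E \<Longrightarrow> x \<in> S \<Longrightarrow> y \<in> S \<Longrightarrow> (x, y) \<in> rtrancl_on S E"
  by (rule rtrancl_on_into_rtrancl_on[OF rtrancl_on_refl])

lemma rtrancl_on_mono_set:
  assumes "(x, y) \<in> rtrancl_on A E" "A \<subseteq> B"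
  shows "(x, y) \<in> rtrancl_on B E"
  using assms by (induct rule: rtrancl_on_induct) (auto intro: rtrancl_on_into_rtrancl_on)

lemma rtrancl_on_symI:
  assumes "sym E" "(x, y) \<in> rtrancl_on S E"
  shows "(y, x) \<in> rtrancl_on S E"
  using assms(2) by (induct rule: rtrancl_on_induct)
    (auto intro: converse_rtrancl_on_into_rtrancl_on symD[OF assms(1)])

text \<open>A walk is mapped step by step to a walk in which some steps may collapse. The intended
  \<open>h\<close> overwrites one coordinate.\<close>

lemma linked_image:
  assumes "linked E A"
    and h: "\<And>x y. x \<in> A \<Longrightarrow> y \<in> A \<Longrightarrow> (x, y) \<in> E \<Longrightarrow> h x = h y \<or> (h x, h y) \<in> E"
  shows "linked E (h ` A)"
proof -
  have "(h x, h y) \<in> rtrancl_on (h ` A) E" if "(x, y) \<in> rtrancl_on A E" for x y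
    using that
  proof (induct rule: rtrancl_on_induct)
    case base
    then show ?case by simp
  next
    case (step y z)
    from h[OF step(3,4,2)] step(4,5) show ?case
      by (metis imageI rtrancl_on_into_rtrancl_on)
  qed
  with assms(1) show ?thesis
    by (auto simp: linked_def)
qed

text \<open>Gluing step for three layers: every point of \<open>C\<close> hangs on \<open>A\<close>
  or \<open>B\<close>, and one path through \<open>C\<close> joins \<open>A\<close> to
  \<open>B\<close>. The path is demanded only if both pieces are nonempty, since at the first level
  one of them is empty.\<close>

lemma linked_join:
  assumes E: "sym E" and A: "linked E A" and B: "linked E B"
    and C: "\<And>c. c \<in> C \<Longrightarrow> \<exists>d\<in>A \<union> B. (c, d) \<in> E"
    and AB: "A \<noteq> {} \<Longrightarrow> B \<noteq> {} \<Longrightarrow>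
      \<exists>c\<in>C. \<exists>c'\<in>C. \<exists>a\<in>A. \<exists>b\<in>B. (a, c) \<in> E \<and> (c, c') \<in> E \<and> (c', b) \<in> E"
  shows "linked E (A \<union> B \<union> C)"
proof -
  let ?T = "A \<union> B \<union> C"
  let ?R = "rtrancl_on ?T E"
  have RA: "(x, y) \<in> ?R" if "x \<in> A" "y \<in> A" for x y
    using A that by (auto simp: linked_def intro: rtrancl_on_mono_set)
  have RB: "(x, y) \<in> ?R" if "x \<in> B" "y \<in> B" for x y
    using B that by (auto simp: linked_def intro: rtrancl_on_mono_set)
  have RAB: "(x, y) \<in> ?R" if x: "x \<in> A" and y: "y \<in> B" for x y
  proof -
    from AB x y obtain c c' a b where *: "c \<in> C" "c' \<in> C" "a \<in> A" "b \<in> B"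
      "(a, c) \<in> E" "(c, c') \<in> E" "(c', b) \<in> E" by blast
    then have "(a, b) \<in> ?R"
      by (meson UnI1 UnI2 rtrancl_on_edge rtrancl_on_into_rtrancl_on)
    with RA[OF x *(3)] RB[OF *(4) y] show ?thesis
      by (meson rtrancl_on_trans)
  qed
  have R0: "(x, y) \<in> ?R" if "x \<in> A \<union> B" "y \<in> A \<union> B" for x y
    using that RA RB RAB rtrancl_on_symI[OF E] by blast
  have "\<exists>y\<in>A \<union> B. (x, y) \<in> ?R" if x: "x \<in> ?T" for x
  proof (cases "x \<in> C")
    case True
    with C obtain d where "d \<in> A \<union> B" "(x, d) \<in> E" by blast
    with x show ?thesis by (intro bexI[of _ d] rtrancl_on_edge) auto
  next
    case False
    with x show ?thesis by (intro bexI[of _ x]) auto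
  qed
  then show ?thesis
    unfolding linked_def by (meson R0 rtrancl_on_trans rtrancl_on_symI[OF E])
qed

lemma connected_induce_linked:
  assumes wf: "wf_digraph (with_proj G)" and S: "S \<subseteq> pverts G" "S \<noteq> {}"
    and linked: "linked (parcs G) S"
  shows "Digraph_Component.connected (with_proj G \<restriction> S)"
proof -
  interpret G: wf_digraph "with_proj G" by fact
  have "(u, v) \<in> rtrancl_on S ((arcs_ends (with_proj G \<restriction> S))\<^sup>s)"
    if "(u, v) \<in> rtrancl_on S (parcs G)" for u v
    using that
  proof (induct rule: rtrancl_on_induct)
    case base
    then show ?case by simp
  next
    case (step y z)
    then have "(y, z) \<in> arcs_ends (with_proj G \<restriction> S)"
      by (auto simp: arcs_ends_conv image_iff intro: bexI[of _ "(y, z)"])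
    with step(4,5) show ?case
      by (auto simp: symcl_def intro: rtrancl_on_into_rtrancl_on)
  qed
  with linked S show ?thesis
    by (auto simp: connected_conv linked_def)
qed

lemma induced_subgraph_eq_induce:
  assumes "induced_subgraph H G"
  shows "H = G \<restriction> (verts H)"
  using assms
  by (auto simp: induced_subgraph_def subgraph_def compatible_def induce_subgraph_def
      intro!: pre_digraph.equality)

text \<open>The subgraph induced by \<open>S\<close> is itself a candidate and contains all others,
  so it is the only maximal one.\<close>

lemma max_connected_induced_on_linked:
  assumes wf: "wf_digraph (with_proj G)" and S: "S \<subseteq> pverts G" "S \<noteq> {}"
    and linked: "linked (parcs G) S"
  shows "max_connected_induced_on G S = {with_proj G \<restriction> S}"
proof -
  interpret G: wf_digraph "with_proj G" by fact
  let ?H = "with_proj G \<restriction> S"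
  have H: "induced_subgraph ?H (with_proj G)" "Digraph_Component.connected ?H"
    using S connected_induce_linked[OF assms] by (simp_all add: G.induced_induce)
  have "K = ?H" if "K \<in> max_connected_induced_on G S" for K
  proof -
    from that have K: "induced_subgraph K (with_proj G)" "verts K \<subseteq> S"
      and max: "\<not> (\<exists>H'. induced_subgraph H' (with_proj G) \<and>
        Digraph_Component.connected H' \<and> verts H' \<subseteq> S \<and> verts K \<subset> verts H')"
      by (simp_all add: max_connected_induced_on_def)
    have "\<not> verts K \<subset> S"
    proof
      assume "verts K \<subset> S"
      with H have "induced_subgraph ?H (with_proj G) \<and> Digraph_Component.connected ?H \<and>
          verts ?H \<subseteq> S \<and> verts K \<subset> verts ?H" by simp
      with max show False by blast
    qed
    with K(2) have "verts K = S" by blast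
    with induced_subgraph_eq_induce[OF K(1)] show ?thesis by simp
  qed
  moreover have "?H \<in> max_connected_induced_on G S"
    using H by (auto simp: max_connected_induced_on_def)
  ultimately show ?thesis by blast
qed

lemma SND_eq_2:
  assumes wf: "wf_digraph (with_proj G)"
    and pos: "linked (parcs G) {x \<in> pverts G. f x > 0}" "{x \<in> pverts G. f x > 0} \<noteq> {}"
    and neg: "linked (parcs G) {x \<in> pverts G. f x < 0}" "{x \<in> pverts G. f x < 0} \<noteq> {}"
  shows "SND G f = 2"
proof -
  let ?P = "{x \<in> pverts G. f x > 0}" and ?N = "{x \<in> pverts G. f x < 0}"
  \<comment> \<open>Otherwise the union in \<open>SND\<close> could collapse to a single
    subgraph.\<close>
  have "?P \<noteq> ?N"
    using pos(2) by force
  then have "with_proj G \<restriction> ?P \<noteq> with_proj G \<restriction> ?N"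
    by (metis induce_subgraph_verts)
  moreover have "pos_strong_nodal_domains G f = {with_proj G \<restriction> ?P}"
    unfolding pos_strong_nodal_domains_def
    by (rule max_connected_induced_on_linked[OF wf _ pos(2,1)]) auto
  moreover have "neg_strong_nodal_domains G f = {with_proj G \<restriction> ?N}"
    unfolding neg_strong_nodal_domains_def
    by (rule max_connected_induced_on_linked[OF wf _ neg(2,1)]) auto
  ultimately show ?thesis
    by (simp add: SND_def)
qed

section \<open>Arcs and neighbours in the Hamming graph\<close>

lemma pverts_hamming_graph: "pverts (hamming_graph n q) = {..<n} \<rightarrow>\<^sub>E {..<q}"
  by (simp add: hamming_graph_def)

lemma upd_in_pverts_hamming_graph:
  assumes "x \<in> pverts (hamming_graph n q)" "k < n" "v < q"
  shows "x(k := v) \<in> pverts (hamming_graph n q)"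
  using assms by (auto simp: pverts_hamming_graph PiE_iff extensional_def)

text \<open>Trades the cardinality condition for a function update, the form in which the recursion
  for the eigenfunctions can be evaluated.\<close>

lemma parcs_hamming_graph_iff:
  assumes x: "x \<in> pverts (hamming_graph n q)"
  shows "(x, y) \<in> parcs (hamming_graph n q) \<longleftrightarrow>
    (\<exists>k<n. \<exists>v<q. v \<noteq> x k \<and> y = x(k := v))"
proof
  assume "(x, y) \<in> parcs (hamming_graph n q)"
  then have y: "y \<in> {..<n} \<rightarrow>\<^sub>E {..<q}" and "card {k \<in> {..<n}. x k \<noteq> y k} = 1"
    by (auto simp: hamming_graph_def)
  then obtain k where k: "{k \<in> {..<n}. x k \<noteq> y k} = {k}"
    by (metis card_1_singletonE)
  have diff: "j < n \<and> x j \<noteq> y j \<longleftrightarrow> j = k" for j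
    using arg_cong[OF k, of "\<lambda>A. j \<in> A"] by simp
  have "y = x(k := y k)"
  proof
    fix j
    show "y j = (x(k := y k)) j"
    proof (cases "j < n")
      case True
      then show ?thesis using diff[of j] by auto
    next
      case False
      then have "x j = undefined" "y j = undefined"
        using PiE_arb[OF x[unfolded pverts_hamming_graph]] PiE_arb[OF y] by simp_all
      moreover have "j \<noteq> k" using False diff[of k] by auto
      ultimately show ?thesis by simp
    qed
  qed
  moreover have "k < n" "y k \<noteq> x k" using diff[of k] by simp_all
  moreover have "y k < q" using PiE_mem[OF y, of k] \<open>k < n\<close> by simp
  ultimately show "\<exists>k<n. \<exists>v<q. v \<noteq> x k \<and> y = x(k := v)" by blast
next
  assume "\<exists>k<n. \<exists>v<q. v \<noteq> x k \<and> y = x(k := v)"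
  then obtain k v where kv: "k < n" "v < q" "v \<noteq> x k" "y = x(k := v)" by blast
  then have "{j \<in> {..<n}. x j \<noteq> y j} = {k}" by auto
  then show "(x, y) \<in> parcs (hamming_graph n q)"
    using x upd_in_pverts_hamming_graph[OF x kv(1,2)] kv(4)
    by (simp add: hamming_graph_def)
qed

text \<open>The term \<open>v = x k\<close> is zero and is added so that each direction sums over
  all residues, where zero-sum weights cancel.\<close>

lemma sum_neighbours_hamming_graph:
  assumes x: "x \<in> pverts (hamming_graph n q)"
  shows "(\<Sum>y\<in>neighbours (hamming_graph n q) x. f x - f y) =
    (\<Sum>k<n. \<Sum>v<q. f x - f (x(k := v)) :: real)"
proof -
  let ?I = "SIGMA k:{..<n}. {..<q} - {x k}"
  have "neighbours (hamming_graph n q) x = (\<lambda>(k, v). x(k := v)) ` ?I"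
    using x by (force simp: neighbours_def parcs_hamming_graph_iff)
  moreover have "inj_on (\<lambda>(k, v). x(k := v)) ?I"
  proof -
    \<comment> \<open>As \<open>v \<noteq> x k\<close>, the coordinate \<open>k\<close> is where the
      updated word differs from \<open>x\<close>.\<close>
    have kl: "k = l \<and> v = w" if "v \<noteq> x k" and eq: "x(k := v) = x(l := w)" for k v l w
    proof -
      have "k = l"
        using fun_cong[OF eq, of k] that(1) by (cases "k = l") simp_all
      then show ?thesis
        using fun_cong[OF eq, of k] by simp
    qed
    show ?thesis
      by (rule inj_onI) (use kl in \<open>auto simp del: fun_upd_apply\<close>)
  qed
  ultimately have "(\<Sum>y\<in>neighbours (hamming_graph n q) x. f x - f y) =
      (\<Sum>(k, v)\<in>?I. f x - f (x(k := v)))"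
    by (simp add: sum.reindex case_prod_unfold comp_def)
  also have "\<dots> = (\<Sum>k<n. \<Sum>v\<in>{..<q} - {x k}. f x - f (x(k := v)))"
    by (subst sum.Sigma) auto
  also have "\<dots> = (\<Sum>k<n. \<Sum>v<q. f x - f (x(k := v)))"
    by (intro sum.cong refl sum.mono_neutral_left) auto
  finally show ?thesis .
qed

lemma wf_digraph_hamming_graph: "wf_digraph (with_proj (hamming_graph n q))"
proof -
  interpret pair_graph "hamming_graph n q" by (rule pair_graph_hamming_graph)
  show ?thesis by (rule wf_digraph)
qed

lemma sym_parcs_hamming_graph: "sym (parcs (hamming_graph n q))"
proof -
  interpret pair_graph "hamming_graph n q" by (rule pair_graph_hamming_graph)
  show ?thesis using sym_arcs by (simp add: symmetric_def)
qed

text \<open>Projection to a layer: arcs in direction \<open>m\<close> collapse, all others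
  survive.\<close>

lemma hamming_graph_fix_coordinate:
  assumes "(x, y) \<in> parcs (hamming_graph n q)" "m < n" "c < q"
  shows "x(m := c) = y(m := c) \<or> (x(m := c), y(m := c)) \<in> parcs (hamming_graph n q)"
proof -
  have x: "x \<in> pverts (hamming_graph n q)"
    using assms(1) by (auto simp: hamming_graph_def)
  with assms(1) obtain k v where kv: "k < n" "v < q" "v \<noteq> x k" "y = x(k := v)"
    by (auto simp: parcs_hamming_graph_iff)
  show ?thesis
  proof (cases "k = m")
    case True
    with kv show ?thesis by simp
  next
    case False
    with kv have "y(m := c) = (x(m := c))(k := v)" "v \<noteq> (x(m := c)) k"
      by (auto simp: fun_upd_twist)
    with kv(1,2) parcs_hamming_graph_iff[OF upd_in_pverts_hamming_graph[OF x assms(2,3)]]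
    show ?thesis by blast
  qed
qed

section \<open>The eigenfunctions\<close>

text \<open>Nowhere zero, so that products of these weights always have a sign.\<close>

definition wt_a :: "nat \<Rightarrow> real" where
  "wt_a v = (if v = 2 then - 2 else 1)"

text \<open>The zero at 2 leaves only the product term on layer 2.\<close>

definition wt_b :: "nat \<Rightarrow> real" where
  "wt_b v = (if v = 0 then 1 else if v = 1 then - 1 else 0)"

definition prod_a :: "nat \<Rightarrow> (nat \<Rightarrow> nat) \<Rightarrow> real" where
  "prod_a m x = (\<Prod>k<m. wt_a (x k))"

primrec eigenfun :: "nat \<Rightarrow> (nat \<Rightarrow> nat) \<Rightarrow> real" where
  "eigenfun 0 x = 1"
| "eigenfun (Suc i) x =
    (2 ^ Suc i + 1) * eigenfun i x * wt_b (x (Suc i)) + prod_a (Suc i) x"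

lemma sum_lessThan_3: "(\<Sum>v<3. g v) = g 0 + g 1 + g (2 :: nat)"
  by (simp add: eval_nat_numeral)

lemma prod_a_upd_ge: "m \<le> k \<Longrightarrow> prod_a m (x(k := v)) = prod_a m x"
  by (auto simp: prod_a_def intro: prod.cong)

lemma sum_prod_a_upd:
  assumes "k < m"
  shows "(\<Sum>v<3. prod_a m (x(k := v))) = 0"
proof -
  have "prod_a m (x(k := v)) = wt_a v * (\<Prod>j\<in>{..<m} - {k}. wt_a (x j))" for v
    using assms by (simp add: prod_a_def prod.remove[of _ k])
  then show ?thesis
    by (simp add: sum_lessThan_3 wt_a_def)
qed

lemma eigenfun_upd_gt: "i < k \<Longrightarrow> eigenfun i (x(k := v)) = eigenfun i x"
  by (induct i) (auto simp: prod_a_upd_ge)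

text \<open>Each summand of the recursion gains the factor \<open>3 * Suc i\<close>. The first gets
  \<open>3 * i\<close> from the directions up to \<open>i\<close> by induction and 3 from direction
  \<open>Suc i\<close>; the product gets 3 from each of the \<open>Suc i\<close> lower directions
  and nothing from the last.\<close>

lemma eigenfun_laplacian:
  "(\<Sum>k<Suc i. \<Sum>v<3. eigenfun i x - eigenfun i (x(k := v))) = 3 * real i * eigenfun i x"
proof (induct i)
  case 0
  then show ?case by simp
next
  case (Suc i)
  let ?c = "2 ^ Suc i + 1 :: real"
  have low: "(\<Sum>v<3. eigenfun (Suc i) x - eigenfun (Suc i) (x(k := v))) =
      ?c * wt_b (x (Suc i)) * (\<Sum>v<3. eigenfun i x - eigenfun i (x(k := v)))
      + 3 * prod_a (Suc i) x" if "k < Suc i" for k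
    using that sum_prod_a_upd[OF that, of x]
    by (simp add: sum_lessThan_3 algebra_simps)
  have top: "(\<Sum>v<3. eigenfun (Suc i) x - eigenfun (Suc i) (x(Suc i := v))) =
      3 * ?c * eigenfun i x * wt_b (x (Suc i))"
    by (simp add: sum_lessThan_3 eigenfun_upd_gt prod_a_upd_ge wt_b_def algebra_simps)
  have "(\<Sum>k<Suc (Suc i). \<Sum>v<3. eigenfun (Suc i) x - eigenfun (Suc i) (x(k := v))) =
     (\<Sum>k<Suc i. ?c * wt_b (x (Suc i)) * (\<Sum>v<3. eigenfun i x - eigenfun i (x(k := v)))
      + 3 * prod_a (Suc i) x) + 3 * ?c * eigenfun i x * wt_b (x (Suc i))"
    unfolding sum.lessThan_Suc[of _ "Suc i"] top
    by (intro arg_cong2[of _ _ _ _ "(+)"] sum.cong refl low) simp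
  also have "\<dots> = ?c * wt_b (x (Suc i)) * (3 * real i * eigenfun i x)
      + real (Suc i) * (3 * prod_a (Suc i) x) + 3 * ?c * eigenfun i x * wt_b (x (Suc i))"
    by (simp only: sum.distrib sum_distrib_left[symmetric] Suc sum_constant card_lessThan)
  also have "\<dots> = 3 * real (Suc i) * eigenfun (Suc i) x"
    by (simp add: algebra_simps)
  finally show ?case .
qed

lemma abs_prod_a_bounds: "1 \<le> \<bar>prod_a m x\<bar> \<and> \<bar>prod_a m x\<bar> \<le> 2 ^ m"
proof (induct m)
  case 0
  then show ?case by (simp add: prod_a_def)
next
  case (Suc m)
  have "prod_a (Suc m) x = prod_a m x * wt_a (x m)"
    by (simp add: prod_a_def)
  with Suc show ?case
    by (auto simp: wt_a_def abs_mult)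
qed

text \<open>Both claims come from one case split. On layers 0 and 1 the first summand is at least
  \<open>2 ^ Suc i + 1\<close> in absolute value and beats the product by at least 1; on layer 2
  only the product is left. The lower bound feeds the next level.\<close>

lemma abs_eigenfun_ge_1: "1 \<le> \<bar>eigenfun i x\<bar>"
  and sgn_eigenfun_Suc: "sgn (eigenfun (Suc i) x) =
    (if x (Suc i) = 0 then sgn (eigenfun i x)
     else if x (Suc i) = 1 then - sgn (eigenfun i x) else sgn (prod_a (Suc i) x))"
proof -
  have step: "1 \<le> \<bar>eigenfun (Suc i) x\<bar> \<and> sgn (eigenfun (Suc i) x) =
    (if x (Suc i) = 0 then sgn (eigenfun i x)
     else if x (Suc i) = 1 then - sgn (eigenfun i x) else sgn (prod_a (Suc i) x))"
    if i: "1 \<le> \<bar>eigenfun i x\<bar>" for i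
  proof -
    define c e p where "c = (2 ^ Suc i :: real)" "e = eigenfun i x" "p = prod_a (Suc i) x"
    have p: "1 \<le> \<bar>p\<bar>" "\<bar>p\<bar> \<le> c"
      using abs_prod_a_bounds[of "Suc i" x] by (auto simp: c_e_p_def)
    have F: "eigenfun (Suc i) x = (c + 1) * e * wt_b (x (Suc i)) + p"
      by (simp add: c_e_p_def)
    have c: "0 \<le> c" by (simp add: c_e_p_def)
    have e: "1 \<le> \<bar>e\<bar>" using i by (simp add: c_e_p_def)
    define q where "q = (c + 1) * e"
    have "e > 0 \<and> q \<ge> c + 1 \<or> e < 0 \<and> q \<le> - (c + 1)"
      using e c mult_left_mono[of 1 e "c + 1"] mult_left_mono[of e "- 1" "c + 1"]
      unfolding q_def by (cases "e > 0") (simp_all del: mult_le_cancel_left1 mult_le_cancel_left2)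
    then show ?thesis
      unfolding F c_e_p_def(2)[symmetric] c_e_p_def(3)[symmetric] q_def[symmetric]
      using p c by (auto simp: wt_b_def sgn_if)
  qed
  show ge: "1 \<le> \<bar>eigenfun i x\<bar>" for i
    by (induct i) (use step in auto)
  show "sgn (eigenfun (Suc i) x) =
    (if x (Suc i) = 0 then sgn (eigenfun i x)
     else if x (Suc i) = 1 then - sgn (eigenfun i x) else sgn (prod_a (Suc i) x))"
    using step[OF ge] by blast
qed

lemma eigenfunction_eigenfun:
  assumes "i < n"
  shows "eigenfunction (hamming_graph n 3) (3 * real i) (eigenfun i)"
proof -
  have "(\<lambda>k\<in>{..<n}. 0) \<in> pverts (hamming_graph n 3)"
    by (auto simp: pverts_hamming_graph)
  moreover have "eigenfun i x \<noteq> 0" for x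
    using abs_eigenfun_ge_1[of i x] by auto
  moreover have "3 * real i * eigenfun i x =
      (\<Sum>y\<in>neighbours (hamming_graph n 3) x. eigenfun i x - eigenfun i y)"
    if "x \<in> pverts (hamming_graph n 3)" for x
  proof -
    \<comment> \<open>\<open>eigenfun i\<close> reads no coordinate beyond \<open>i\<close>, so
      those directions contribute zero.\<close>
    have "(\<Sum>k<n. \<Sum>v<3. eigenfun i x - eigenfun i (x(k := v))) =
        (\<Sum>k<Suc i. \<Sum>v<3. eigenfun i x - eigenfun i (x(k := v)))"
      using assms by (intro sum.mono_neutral_right) (auto simp: eigenfun_upd_gt)
    then show ?thesis
      using that by (simp only: sum_neighbours_hamming_graph eigenfun_laplacian)
  qed
  ultimately show ?thesis
    by (auto simp: eigenfunction_def)
qed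

section \<open>Connectivity of the sign classes\<close>

definition sign_class :: "nat \<Rightarrow> nat \<Rightarrow> real \<Rightarrow> (nat \<Rightarrow> nat) set" where
  "sign_class n i s = {x \<in> pverts (hamming_graph n 3). sgn (eigenfun i x) = s}"

text \<open>\<open>eigenfun i\<close> ignores coordinate \<open>m\<close>, so the layer is the image
  of the whole class under setting that coordinate to \<open>c\<close>.\<close>

lemma linked_sign_class_layer:
  assumes "linked (parcs (hamming_graph n 3)) (sign_class n i s)" "i < m" "m < n" "c < 3"
  shows "linked (parcs (hamming_graph n 3)) (sign_class n i s \<inter> {x. x m = c})"
proof -
  have "sign_class n i s \<inter> {x. x m = c} = (\<lambda>x. x(m := c)) ` sign_class n i s" (is "?L = ?R")
  proof (rule Set.equalityI)
    show "?L \<subseteq> ?R"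
    proof
      fix x assume "x \<in> ?L"
      then have "x = x(m := c)" "x \<in> sign_class n i s" by auto
      then show "x \<in> ?R" by blast
    qed
    show "?R \<subseteq> ?L"
      using assms(2-4) by (auto simp: sign_class_def eigenfun_upd_gt upd_in_pverts_hamming_graph)
  qed
  with linked_image[OF assms(1), of "\<lambda>x. x(m := c)"] show ?thesis
    by (simp add: hamming_graph_fix_coordinate assms(3,4))
qed

lemma sgn_eigenfun_cases: "sgn (eigenfun i x) = 1 \<or> sgn (eigenfun i x) = - 1"
  using abs_eigenfun_ge_1[of i x] by (auto simp: sgn_if)

text \<open>
  For \<open>s = 1\<close> take the word \<open>0\<dots>0\<close> on coordinates \<open>0, \<dots>, i\<close>, for \<open>s = -1\<close> the word \<open>20\<dots>0\<close>;
  flipping coordinate \<open>i \<ge> 1\<close> between 0 and 1 changes the sign of \<open>eigenfun i\<close> only.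
\<close>

lemma sign_change_edge:
  assumes i: "1 \<le> i" "Suc i < n" and s: "s = 1 \<or> s = - 1"
  obtains u w where "u \<in> pverts (hamming_graph n 3)" "w \<in> pverts (hamming_graph n 3)"
    "(u, w) \<in> parcs (hamming_graph n 3)" "u (Suc i) = 2" "w (Suc i) = 2"
    "sgn (prod_a (Suc i) u) = s" "sgn (prod_a (Suc i) w) = s"
    "sgn (eigenfun i u) = s" "sgn (eigenfun i w) = - s"
proof -
  let ?G = "hamming_graph n 3"
  define u where
    "u = (\<lambda>k\<in>{..<n}. if k = Suc i then 2 else if k = 0 \<and> s = - 1 then 2 else (0::nat))"
  define w where "w = u(i := 1)"
  have u: "u \<in> pverts ?G" by (auto simp: u_def pverts_hamming_graph)
  have ui: "u i = 0" "u (Suc i) = 2" using i by (auto simp: u_def)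
  have pu: "prod_a (Suc i) u = (if s = 1 then 1 else - 2)"
  proof -
    have "prod_a (Suc i) u = wt_a (u 0) * (\<Prod>k\<in>{..<Suc i} - {0}. wt_a (u k))"
      unfolding prod_a_def by (rule prod.remove) auto
    also have "(\<Prod>k\<in>{..<Suc i} - {0}. wt_a (u k)) = 1"
      using i by (intro prod.neutral) (auto simp: u_def wt_a_def)
    finally have "prod_a (Suc i) u = wt_a (u 0)" by simp
    moreover have "u 0 = (if s = 1 then 0 else 2)" using s i by (auto simp: u_def)
    ultimately show ?thesis by (simp add: wt_a_def)
  qed
  \<comment> \<open>\<open>wt_a\<close> takes the same value at 0 and 1.\<close>
  have pw: "prod_a (Suc i) w = prod_a (Suc i) u"
    unfolding prod_a_def w_def using ui by (intro prod.cong) (auto simp: wt_a_def)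
  obtain j where j: "i = Suc j" using i by (cases i) auto
  have "sgn (eigenfun i w) = - sgn (eigenfun i u)"
    using ui unfolding j by (simp add: w_def j sgn_eigenfun_Suc eigenfun_upd_gt del: eigenfun.simps)
  moreover have uw: "(u, w) \<in> parcs ?G"
  proof -
    have "i < n" "1 < (3 :: nat)" "1 \<noteq> u i" using i ui by auto
    then show ?thesis
      unfolding parcs_hamming_graph_iff[OF u] w_def by blast
  qed
  moreover have w: "w \<in> pverts ?G"
    using u i by (simp add: w_def upd_in_pverts_hamming_graph)
  moreover have "(w, u) \<in> parcs ?G"
    using uw sym_parcs_hamming_graph by (rule symD[rotated])
  moreover have "w (Suc i) = 2" using ui by (simp add: w_def)
  moreover have "sgn (prod_a (Suc i) u) = s" "sgn (prod_a (Suc i) w) = s"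
    using s pu pw by auto
  \<comment> \<open>The sign of \<open>eigenfun i u\<close> is not computed: it differs from that at
    \<open>w\<close>, so the edge is used in whichever orientation fits \<open>s\<close>.\<close>
  ultimately show ?thesis
    using that[of u w] that[of w u] u ui s sgn_eigenfun_cases[of i u] by (smt (verit))
qed

text \<open>The sign is generalised in the induction because layer 1 carries the class of sign
  \<open>- s\<close> of the previous level.\<close>

lemma linked_sign_class:
  assumes "i < n" "s = 1 \<or> s = - 1"
  shows "linked (parcs (hamming_graph n 3)) (sign_class n i s)"
  using assms
proof (induct i arbitrary: s)
  case 0
  let ?G = "hamming_graph n 3"
  \<comment> \<open>\<open>eigenfun 0\<close> is constant, so its classes are the whole graph and
    the empty set. Connectivity of the whole graph: \<open>x\<close> is changed into
    \<open>y\<close> one coordinate at a time, the first \<open>m\<close> being done.\<close>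
  have reach: "\<exists>z\<in>pverts ?G. (x, z) \<in> rtrancl_on (pverts ?G) (parcs ?G) \<and> (\<forall>k<m. z k = y k) \<and>
      (\<forall>k\<ge>m. z k = x k)"
    if "x \<in> pverts ?G" "y \<in> pverts ?G" "m \<le> n" for x y m
    using that(3)
  proof (induct m)
    case 0
    with that show ?case by (intro bexI[of _ x]) auto
  next
    case (Suc m)
    from Suc.hyps[OF Suc_leD[OF Suc.prems]]
    obtain z where z: "z \<in> pverts ?G" "(x, z) \<in> rtrancl_on (pverts ?G) (parcs ?G)"
      "\<forall>k<m. z k = y k" "\<forall>k\<ge>m. z k = x k" by (elim bexE conjE)
    let ?z = "z(m := y m)"
    have ym: "y m < 3" using PiE_mem[OF that(2)[unfolded pverts_hamming_graph], of m] Suc.prems by simp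
    with z(1) Suc.prems have z': "?z \<in> pverts ?G"
      by (simp add: upd_in_pverts_hamming_graph)
    have "z = ?z \<or> (z, ?z) \<in> parcs ?G"
      using Suc.prems ym parcs_hamming_graph_iff[OF z(1), of ?z]
      by (metis Suc_le_lessD fun_upd_triv)
    then have "(x, ?z) \<in> rtrancl_on (pverts ?G) (parcs ?G)"
      using z(2) z' by (metis rtrancl_on_into_rtrancl_on)
    moreover have "\<forall>k<Suc m. ?z k = y k" "\<forall>k\<ge>Suc m. ?z k = x k"
      using z(3,4) by (auto simp: less_Suc_eq)
    ultimately show ?case using z' by blast
  qed
  have "linked (parcs ?G) (pverts ?G)"
    unfolding linked_def
  proof (intro ballI)
    fix x y assume xy: "x \<in> pverts ?G" "y \<in> pverts ?G"
    from reach[OF xy le_refl] obtain z where z: "z \<in> pverts ?G"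
      "(x, z) \<in> rtrancl_on (pverts ?G) (parcs ?G)" "\<forall>k<n. z k = y k" by blast
    have "z = y"
      by (rule PiE_ext[of _ "{..<n}" "\<lambda>_. {..<3}"]) (use z xy in \<open>auto simp: pverts_hamming_graph\<close>)
    with z show "(x, y) \<in> rtrancl_on (pverts ?G) (parcs ?G)" by simp
  qed
  then show ?case
    using 0 by (auto simp: sign_class_def linked_def)
next
  case (Suc i)
  let ?G = "hamming_graph n 3" and ?m = "Suc i"
  \<comment> \<open>The parts of the new class on the layers 0, 1 and 2 of coordinate
    \<open>?m\<close>.\<close>
  define A where "A = sign_class n i s \<inter> {x. x ?m = 0}"
  define B where "B = sign_class n i (- s) \<inter> {x. x ?m = 1}"
  define C where "C = {x \<in> pverts ?G. x ?m = 2 \<and> sgn (prod_a ?m x) = s}"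
  have m: "i < ?m" "?m < n" "i < n" using Suc.prems by auto
  have neg: "- s = 1 \<or> - s = - 1" using Suc.prems(2) by auto
  have mem: "x ?m = 0 \<or> x ?m = 1 \<or> x ?m = 2" if "x \<in> pverts ?G" for x
  proof -
    from that m have "x ?m < 3" by (auto simp: pverts_hamming_graph)
    then show ?thesis by auto
  qed
  have "x \<in> sign_class n ?m s \<longleftrightarrow> x \<in> A \<union> B \<union> C" for x
  proof (cases "x \<in> pverts ?G")
    case True
    show ?thesis
      using mem[OF True] by (elim disjE)
        (auto simp: A_def B_def C_def sign_class_def sgn_eigenfun_Suc simp del: eigenfun.simps)
  next
    case False
    then show ?thesis by (simp add: A_def B_def C_def sign_class_def)
  qed
  then have "sign_class n ?m s = A \<union> B \<union> C" by blast
  moreover have "linked (parcs ?G) (A \<union> B \<union> C)"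
  proof (rule linked_join[OF sym_parcs_hamming_graph])
    show "linked (parcs ?G) A"
      unfolding A_def using Suc.prems m by (intro linked_sign_class_layer Suc.hyps) simp_all
    show "linked (parcs ?G) B"
      unfolding B_def using neg m by (intro linked_sign_class_layer Suc.hyps) simp_all
    \<comment> \<open>Changing coordinate \<open>?m\<close> keeps the sign of
      \<open>eigenfun i\<close>, and that sign decides whether the neighbour of \<open>c\<close> in
      layer 0 or the one in layer 1 is in the class.\<close>
    have down: "(c, c(?m := 0)) \<in> parcs ?G \<and> (c, c(?m := 1)) \<in> parcs ?G \<and>
        (sgn (eigenfun i c) = s \<longrightarrow> c(?m := 0) \<in> A) \<and>
        (sgn (eigenfun i c) = - s \<longrightarrow> c(?m := 1) \<in> B)"
      if "c \<in> C" for c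
    proof -
      from that have c: "c \<in> pverts ?G" "c ?m = 2" by (auto simp: C_def)
      have "(c, c(?m := v)) \<in> parcs ?G" if "v < 2" for v
      proof -
        have "v < 3" "v \<noteq> c ?m" using that c(2) by simp_all
        then show ?thesis
          unfolding parcs_hamming_graph_iff[OF c(1)] using m(2) by blast
      qed
      with c m show ?thesis
        by (simp add: A_def B_def sign_class_def eigenfun_upd_gt upd_in_pverts_hamming_graph)
    qed
    show "\<exists>d\<in>A \<union> B. (c, d) \<in> parcs ?G" if "c \<in> C" for c
    proof -
      have "sgn (eigenfun i c) = s \<or> sgn (eigenfun i c) = - s"
        using sgn_eigenfun_cases[of i c] Suc.prems(2) by auto
      with down[OF that] show ?thesis by blast
    qed
    assume "A \<noteq> {}" "B \<noteq> {}"
    \<comment> \<open>For \<open>i = 0\<close> the constant \<open>eigenfun 0\<close> cannot take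
      both signs, so \<open>A\<close> or \<open>B\<close> would be empty.\<close>
    then have "1 \<le> i"
      using Suc.prems(2) by (cases i) (auto simp: A_def B_def sign_class_def)
    from sign_change_edge[OF this m(2) Suc.prems(2)]
    obtain u w where uw: "u \<in> pverts ?G" "w \<in> pverts ?G" "(u, w) \<in> parcs ?G"
      "u ?m = 2" "w ?m = 2" "sgn (prod_a ?m u) = s" "sgn (prod_a ?m w) = s"
      "sgn (eigenfun i u) = s" "sgn (eigenfun i w) = - s" .
    then have C: "u \<in> C" "w \<in> C" by (simp_all add: C_def)
    \<comment> \<open>The bridge goes from layer 0 up to \<open>u\<close>, across to
      \<open>w\<close> within layer 2, and down to layer 1.\<close>
    have "(u(?m := 0), u) \<in> parcs ?G" "u(?m := 0) \<in> A"
      "(w, w(?m := 1)) \<in> parcs ?G" "w(?m := 1) \<in> B"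
      using down[OF C(1)] down[OF C(2)] uw(8,9) symD[OF sym_parcs_hamming_graph] by simp_all
    with C uw(3) show "\<exists>c\<in>C. \<exists>c'\<in>C. \<exists>a\<in>A. \<exists>b\<in>B.
        (a, c) \<in> parcs ?G \<and> (c, c') \<in> parcs ?G \<and> (c', b) \<in> parcs ?G"
      by blast
  qed
  ultimately show ?case by simp
qed

text \<open>Layers 0 and 1 of coordinate \<open>i\<close> carry opposite signs; this fails for the
  constant \<open>eigenfun 0\<close>.\<close>

lemma sign_class_nonempty:
  assumes "1 \<le> i" "i < n" "s = 1 \<or> s = - 1"
  shows "sign_class n i s \<noteq> {}"
proof -
  obtain j where j: "i = Suc j" using assms by (cases i) auto
  let ?x = "\<lambda>k\<in>{..<n}. 0 :: nat"
  have "?x \<in> pverts (hamming_graph n 3)"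
    by (auto simp: pverts_hamming_graph)
  then have "?x(i := v) \<in> pverts (hamming_graph n 3)" if "v < 3" for v
    using that assms by (simp add: upd_in_pverts_hamming_graph)
  moreover have "sgn (eigenfun i (?x(i := 0))) = sgn (eigenfun j ?x)"
    "sgn (eigenfun i (?x(i := 1))) = - sgn (eigenfun j ?x)"
    unfolding j by (simp_all add: sgn_eigenfun_Suc eigenfun_upd_gt del: eigenfun.simps)
  ultimately have "?x(i := 0) \<in> sign_class n i (sgn (eigenfun j ?x))"
    "?x(i := 1) \<in> sign_class n i (- sgn (eigenfun j ?x))"
    by (simp_all add: sign_class_def)
  then show ?thesis
    using sgn_eigenfun_cases[of j ?x] assms(3) by auto
qed

theorem theorem6:
  fixes n i :: nat
  assumes "n \<ge> 2" and "i \<in> {1..n - 1}"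
  shows "\<exists>f. eigenfunction (hamming_graph n 3) (3 * real i) f \<and> SND (hamming_graph n 3) f = 2"
proof -
  have i: "1 \<le> i" "i < n" using assms by auto
  have "{x \<in> pverts (hamming_graph n 3). eigenfun i x > 0} = sign_class n i 1"
    "{x \<in> pverts (hamming_graph n 3). eigenfun i x < 0} = sign_class n i (- 1)"
    by (auto simp: sign_class_def sgn_1_pos sgn_1_neg)
  then have "SND (hamming_graph n 3) (eigenfun i) = 2"
    using i by (intro SND_eq_2 wf_digraph_hamming_graph)
      (simp_all add: linked_sign_class sign_class_nonempty)
  with eigenfunction_eigenfun[OF i(2)] show ?thesis by blast
qed

end
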